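(* Let $S$ be a set of sorts and $\Sigma$ an $S$-sorted signature such that, for every $S$-sorted set $A$, the support $\{s\in S\mid \mathrm{T}_\Sigma(A)_s\neq\varnothing\}$ of the free $\Sigma$-algebra $\mathbf{T}_\Sigma(A)$ is finite (equivalently, $S$ is finite). Then the ordered set $\mathbf{Form}_{\mathrm{Alg}_{\mathrm{f}}}(\Sigma)$ of all formations of finite $\Sigma$-algebras, ordered by inclusion, is an algebraic lattice.
   Context: Fix a Grothendieck universe $\mathcal{U}$, a set of sorts $S\in\mathcal{U}$ and an $S$-sorted signature $\Sigma$, i.e. a family of sets $\Sigma_{w,s}\in\mathcal{U}$ indexed by $w\in S^{\star}$ (finite words on $S$) and $s\in S$. An $S$-sorted set is a family $A=(A_s)_{s\in S}$ of sets in $\mathcal{U}$ (components may be empty); it is finite if $\coprod_{s\in S}A_s$ is finite. A $\Sigma$-algebra $\mathbf{A}$ is an $S$-sorted set $A$ with an operation $F_\sigma\colon A_w=\prod_{i<|w|}A_{w_i}\to A_s$ for each $\sigma\in\Sigma_{w,s}$; it is finite if $A$ is finite. Homomorphisms are $S$-sorted (componentwise) mappings commuting with all operations. Epimorphism means homomorphism surjective in each sort. $\mathrm{Alg}(\Sigma)$ is the set of all $\Sigma$-algebras; a "set of $\Sigma$-algebras" is any subset of it (not necessarily $\mathcal{U}$-small). A subdirect embedding $f\colon\mathbf{A}\to\prod_{i\in I}\mathbf{C}^i$ is a homomorphism injective in each sort such that each $\mathrm{pr}^i\circ f\colon\mathbf{A}\to\mathbf{C}^i$ is surjective (the empty product is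 the final algebra $\mathbf{1}$, with one element in each sort). A formation of $\Sigma$-algebras is a set $\mathcal{F}\subseteq\mathrm{Alg}(\Sigma)$ such that: (1) $\mathcal{F}\neq\varnothing$; (2) $\mathcal{F}$ is closed under isomorphism; (3) if $\mathbf{B}\in\mathcal{F}$ and there is an epimorphism $\mathbf{B}\to\mathbf{A}$, then $\mathbf{A}\in\mathcal{F}$; (4) if for some $n\in\mathbb{N}$ (including $n=0$) and some family $(\mathbf{C}^{\alpha})_{\alpha<n}$ in $\mathcal{F}$ there is a subdirect embedding $\mathbf{A}\to\prod_{\alpha<n}\mathbf{C}^{\alpha}$, then $\mathbf{A}\in\mathcal{F}$. A formation of finite $\Sigma$-algebras is a formation of $\Sigma$-algebras all of whose members are finite. An algebraic lattice is a complete lattice in which every element is a join of compact elements. *)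

theory Defs
  imports "HOL-Library.FuncSet" "HOL-Algebra.Complete_Lattice"
begin

text \<open>
  The set of sorts is a set \<open>S\<close> over a type, so it may be empty. An \<open>S\<close>-sorted set is a family
  indexed by the whole type; to make families over \<open>S\<close> correspond bijectively to such functions,
  the components outside \<open>S\<close> are required to be empty. The element type \<open>'u\<close> plays the role of
  the Grothendieck universe: finite algebras have finite carriers, and every finite subset of a
  universe belongs to it, so no smallness condition on carriers is needed for them.
\<close>

definition sorted_set :: "'s set \<Rightarrow> ('s \<Rightarrow> 'u set) \<Rightarrow> bool" where
  "sorted_set S A \<longleftrightarrow> (\<forall>s. s \<notin> S \<longrightarrow> A s = {})"

definition finite_sorted_set :: "'s set \<Rightarrow> ('s \<Rightarrow> 'u set) \<Rightarrow> bool" where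
  "finite_sorted_set S A \<longleftrightarrow> finite (SIGMA s:S. A s)"

definition word_product :: "('s \<Rightarrow> 'u set) \<Rightarrow> 's list \<Rightarrow> 'u list set" where
  "word_product A w = {xs. length xs = length w \<and> (\<forall>i<length w. xs ! i \<in> A (w ! i))}"

text \<open>
  Only the components \<open>\<Sigma> w s\<close> with \<open>w \<in> lists S\<close> and \<open>s \<in> S\<close> belong to an \<open>S\<close>-sorted signature
  \<open>\<Sigma>\<close>; all others are ignored. The sets \<open>\<Sigma> w s\<close> need not be disjoint, so an operation is
  determined by a symbol together with its rank \<open>(w, s)\<close>.
\<close>

type_synonym ('s, 'f) signature = "'s list \<Rightarrow> 's \<Rightarrow> 'f set"

definition op_symbol :: "'s set \<Rightarrow> ('s, 'f) signature \<Rightarrow> 's list \<Rightarrow> 's \<Rightarrow> 'f \<Rightarrow> bool" where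
  "op_symbol S \<Sigma> w s \<sigma> \<longleftrightarrow> w \<in> lists S \<and> s \<in> S \<and> \<sigma> \<in> \<Sigma> w s"

record ('s, 'f, 'u) ms_algebra =
  car :: "'s \<Rightarrow> 'u set"
  opn :: "'s list \<Rightarrow> 's \<Rightarrow> 'f \<Rightarrow> 'u list \<Rightarrow> 'u"

text \<open>
  Operations are \<open>undefined\<close> outside their domain, so that equality of algebras is equality of
  carriers and operations.
\<close>

definition Alg :: "'s set \<Rightarrow> ('s, 'f) signature \<Rightarrow> ('s, 'f, 'u) ms_algebra set" where
  "Alg S \<Sigma> = {A. sorted_set S (car A) \<and>
     (\<forall>w s \<sigma>. op_symbol S \<Sigma> w s \<sigma> \<longrightarrow> opn A w s \<sigma> \<in> word_product (car A) w \<rightarrow>\<^sub>E car A s) \<and>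
     (\<forall>w s \<sigma>. \<not> op_symbol S \<Sigma> w s \<sigma> \<longrightarrow> opn A w s \<sigma> = (\<lambda>_. undefined))}"

definition finite_alg :: "'s set \<Rightarrow> ('s, 'f, 'u) ms_algebra \<Rightarrow> bool" where
  "finite_alg S A \<longleftrightarrow> finite_sorted_set S (car A)"

definition ms_hom ::
  "'s set \<Rightarrow> ('s, 'f) signature \<Rightarrow> ('s, 'f, 'u) ms_algebra \<Rightarrow> ('s, 'f, 'v) ms_algebra \<Rightarrow>
   ('s \<Rightarrow> 'u \<Rightarrow> 'v) set" where
  "ms_hom S \<Sigma> A B = {h. (\<forall>s\<in>S. h s \<in> car A s \<rightarrow> car B s) \<and>
     (\<forall>w s \<sigma>. op_symbol S \<Sigma> w s \<sigma> \<longrightarrow> (\<forall>xs \<in> word_product (car A) w.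
        h s (opn A w s \<sigma> xs) = opn B w s \<sigma> (map2 h w xs)))}"

definition ms_epi ::
  "'s set \<Rightarrow> ('s, 'f) signature \<Rightarrow> ('s, 'f, 'u) ms_algebra \<Rightarrow> ('s, 'f, 'v) ms_algebra \<Rightarrow>
   ('s \<Rightarrow> 'u \<Rightarrow> 'v) set" where
  "ms_epi S \<Sigma> A B = {h \<in> ms_hom S \<Sigma> A B. \<forall>s\<in>S. h s ` car A s = car B s}"

definition ms_iso ::
  "'s set \<Rightarrow> ('s, 'f) signature \<Rightarrow> ('s, 'f, 'u) ms_algebra \<Rightarrow> ('s, 'f, 'v) ms_algebra \<Rightarrow>
   ('s \<Rightarrow> 'u \<Rightarrow> 'v) set" where
  "ms_iso S \<Sigma> A B = {h \<in> ms_hom S \<Sigma> A B. \<forall>s\<in>S. bij_betw (h s) (car A s) (car B s)}"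

text \<open>For \<open>I = {}\<close> this is the final algebra, with exactly one element in each sort of \<open>S\<close>.\<close>

definition product_algebra ::
  "'s set \<Rightarrow> ('s, 'f) signature \<Rightarrow> 'i set \<Rightarrow> ('i \<Rightarrow> ('s, 'f, 'u) ms_algebra) \<Rightarrow>
   ('s, 'f, 'i \<Rightarrow> 'u) ms_algebra" where
  "product_algebra S \<Sigma> I C =
     (let P = (\<lambda>s. if s \<in> S then (\<Pi>\<^sub>E i\<in>I. car (C i) s) else {}) in
      \<lparr> car = P,
        opn = (\<lambda>w s \<sigma> xs.
          if op_symbol S \<Sigma> w s \<sigma> \<and> xs \<in> word_product P w
          then (\<lambda>i\<in>I. opn (C i) w s \<sigma> (map (\<lambda>x. x i) xs))
          else undefined) \<rparr>)"

definition subdirect_embedding ::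
  "'s set \<Rightarrow> ('s, 'f) signature \<Rightarrow> ('s, 'f, 'u) ms_algebra \<Rightarrow>
   'i set \<Rightarrow> ('i \<Rightarrow> ('s, 'f, 'u) ms_algebra) \<Rightarrow> ('s \<Rightarrow> 'u \<Rightarrow> 'i \<Rightarrow> 'u) set" where
  "subdirect_embedding S \<Sigma> A I C = {f \<in> ms_hom S \<Sigma> A (product_algebra S \<Sigma> I C).
     (\<forall>s\<in>S. inj_on (f s) (car A s)) \<and>
     (\<forall>i\<in>I. \<forall>s\<in>S. (\<lambda>x. f s x i) ` car A s = car (C i) s)}"

datatype ('s, 'f, 'u) ms_term =
    Var 's 'u
  | App "'s list" 's 'f "('s, 'f, 'u) ms_term list"

inductive well_sorted :: "'s set \<Rightarrow> ('s, 'f) signature \<Rightarrow> ('s \<Rightarrow> 'u set) \<Rightarrow>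
    's \<Rightarrow> ('s, 'f, 'u) ms_term \<Rightarrow> bool"
  for S :: "'s set" and \<Sigma> :: "('s, 'f) signature" and X :: "'s \<Rightarrow> 'u set" where
  Var: "s \<in> S \<Longrightarrow> x \<in> X s \<Longrightarrow> well_sorted S \<Sigma> X s (Var s x)"
| App: "op_symbol S \<Sigma> w s \<sigma> \<Longrightarrow> length ts = length w \<Longrightarrow>
    (\<And>i. i < length w \<Longrightarrow> well_sorted S \<Sigma> X (w ! i) (ts ! i)) \<Longrightarrow>
    well_sorted S \<Sigma> X s (App w s \<sigma> ts)"

definition free_algebra :: "'s set \<Rightarrow> ('s, 'f) signature \<Rightarrow> ('s \<Rightarrow> 'u set) \<Rightarrow>
    ('s, 'f, ('s, 'f, 'u) ms_term) ms_algebra" where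
  "free_algebra S \<Sigma> X =
     (let T = (\<lambda>s. {t. well_sorted S \<Sigma> X s t}) in
      \<lparr> car = T,
        opn = (\<lambda>w s \<sigma> ts.
          if op_symbol S \<Sigma> w s \<sigma> \<and> ts \<in> word_product T w then App w s \<sigma> ts else undefined) \<rparr>)"

definition support :: "'s set \<Rightarrow> ('s \<Rightarrow> 'u set) \<Rightarrow> 's set" where
  "support S A = {s \<in> S. A s \<noteq> {}}"

definition formation :: "'s set \<Rightarrow> ('s, 'f) signature \<Rightarrow> ('s, 'f, 'u) ms_algebra set \<Rightarrow> bool" where
  "formation S \<Sigma> F \<longleftrightarrow>
     F \<subseteq> Alg S \<Sigma> \<and>
     F \<noteq> {} \<and>
     (\<forall>B \<in> F. \<forall>A \<in> Alg S \<Sigma>. ms_iso S \<Sigma> B A \<noteq> {} \<longrightarrow> A \<in> F) \<and>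
     (\<forall>B \<in> F. \<forall>A \<in> Alg S \<Sigma>. ms_epi S \<Sigma> B A \<noteq> {} \<longrightarrow> A \<in> F) \<and>
     (\<forall>(n::nat) C. (\<forall>\<alpha><n. C \<alpha> \<in> F) \<longrightarrow>
        (\<forall>A \<in> Alg S \<Sigma>. subdirect_embedding S \<Sigma> A {..<n} C \<noteq> {} \<longrightarrow> A \<in> F))"

definition finite_formation ::
  "'s set \<Rightarrow> ('s, 'f) signature \<Rightarrow> ('s, 'f, 'u) ms_algebra set \<Rightarrow> bool" where
  "finite_formation S \<Sigma> F \<longleftrightarrow> formation S \<Sigma> F \<and> (\<forall>A \<in> F. finite_alg S A)"

definition Form_fin ::
  "'s set \<Rightarrow> ('s, 'f) signature \<Rightarrow> ('s, 'f, 'u) ms_algebra set gorder" where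
  "Form_fin S \<Sigma> = \<lparr> carrier = {F. finite_formation S \<Sigma> F}, eq = (=), le = (\<subseteq>) \<rparr>"

definition compact_element :: "('a, 'b) gorder_scheme \<Rightarrow> 'a \<Rightarrow> bool" where
  "compact_element L k \<longleftrightarrow> k \<in> carrier L \<and>
     (\<forall>X \<subseteq> carrier L. k \<sqsubseteq>\<^bsub>L\<^esub> \<Squnion>\<^bsub>L\<^esub> X \<longrightarrow> (\<exists>Y \<subseteq> X. finite Y \<and> k \<sqsubseteq>\<^bsub>L\<^esub> \<Squnion>\<^bsub>L\<^esub> Y))"

locale algebraic_lattice = complete_lattice L for L (structure) +
  assumes join_of_compact:
    "x \<in> carrier L \<Longrightarrow> \<exists>K. (\<forall>k\<in>K. compact_element L k) \<and> x = \<Squnion> K"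

end

theory Submission
  imports Defs
begin

text \<open>
  A formation of finite algebras is a set of finite algebras that is closed under rules with
  finitely many premises, so these sets are closed under nonempty intersections and under directed
  unions. (The rule without premises, subdirect embedding into the empty product, keeps
  intersections nonempty.) Since \<open>S\<close> is finite, the final algebra is finite, and the set of all
  finite algebras is the largest formation of finite algebras. Hence the formations of finite
  algebras form an algebraic closure system, in which the closures of singletons are compact.
\<close>

section \<open>Algebraic closure systems as algebraic lattices\<close>

text \<open>A greatest element together with nonempty meets gives completeness, so the empty
  intersection, which would be \<open>UNIV\<close> rather than \<open>U\<close>, never occurs.
  Closure under directed unions makes the closure of a single point compact.\<close>

lemma algebraic_lattice_closure_system:
  assumes top: "U \<in> C" "\<And>F. F \<in> C \<Longrightarrow> F \<subseteq> U"
    and Inter: "\<And>X. X \<subseteq> C \<Longrightarrow> X \<noteq> {} \<Longrightarrow> \<Inter>X \<in> C"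
    and directed: "\<And>X. X \<subseteq> C \<Longrightarrow> X \<noteq> {} \<Longrightarrow>
      (\<And>F G. F \<in> X \<Longrightarrow> G \<in> X \<Longrightarrow> \<exists>H\<in>X. F \<union> G \<subseteq> H) \<Longrightarrow> \<Union>X \<in> C"
  shows "algebraic_lattice \<lparr>carrier = C, eq = (=), le = (\<subseteq>)\<rparr>" (is "algebraic_lattice ?L")
proof -
  have "partial_order ?L"
    by standard auto
  moreover have "\<exists>g. greatest ?L g (carrier ?L)"
    using top by (auto simp: greatest_def)
  moreover have "\<exists>i. greatest ?L i (Lower ?L X)" if "X \<subseteq> carrier ?L" "X \<noteq> {}" for X
  proof
    show "greatest ?L (\<Inter>X) (Lower ?L X)"
      using that Inter[of X] by (auto simp: greatest_def Lower_def)
  qed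
  ultimately have "complete_lattice ?L"
    by (rule partial_order.complete_lattice_criterion1)
  then interpret complete_lattice ?L .
  \<comment> \<open>A join may be strictly larger than the union, so joins are handled only through
    their bounds, written here as inclusions between members of \<open>C\<close>.\<close>
  have Sup_closed: "\<Squnion>\<^bsub>?L\<^esub>X \<in> C" if "X \<subseteq> C" for X
    using sup_closed[of X] that by simp
  have Sup_upper: "F \<subseteq> \<Squnion>\<^bsub>?L\<^esub>X" if "X \<subseteq> C" "F \<in> X" for F X
    using sup_upper[of X F] that by simp
  have Sup_least: "\<Squnion>\<^bsub>?L\<^esub>X \<subseteq> G" if "X \<subseteq> C" "G \<in> C" "\<And>F. F \<in> X \<Longrightarrow> F \<subseteq> G" for G X
    using sup_least[of X G] that by simp
  have Sup_mono: "\<Squnion>\<^bsub>?L\<^esub>X \<subseteq> \<Squnion>\<^bsub>?L\<^esub>Y" if "X \<subseteq> Y" "Y \<subseteq> C" for X Y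
    using that by (intro Sup_least Sup_closed Sup_upper) auto
  \<comment> \<open>For \<open>a\<close> in \<open>U\<close> this is the least member of
    \<open>C\<close> that contains \<open>a\<close>; the family intersected is nonempty because
    \<open>U\<close> belongs to it.\<close>
  define cl where "cl a = \<Inter>{F \<in> C. a \<in> F}" for a
  have cl: "cl a \<in> C" "a \<in> cl a" if "a \<in> U" for a
    using that top Inter[of "{F \<in> C. a \<in> F}"] by (auto simp: cl_def)
  have cl_least: "cl a \<subseteq> F" if "F \<in> C" "a \<in> F" for a F
    using that by (auto simp: cl_def)
  have compact: "compact_element ?L (cl a)" if a: "a \<in> U" for a
    unfolding compact_element_def
  proof (intro conjI allI impI)
    show "cl a \<in> carrier ?L"
      using cl a by simp
    fix X assume "X \<subseteq> carrier ?L" and le: "cl a \<sqsubseteq>\<^bsub>?L\<^esub> \<Squnion>\<^bsub>?L\<^esub>X"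
    then have X: "X \<subseteq> C" by simp
    \<comment> \<open>The joins of finite subfamilies form a directed family, so their union is
      again in \<open>C\<close> and bounds \<open>X\<close>. It therefore contains the join of
      \<open>X\<close>, and \<open>a\<close> already lies in the join of some finite subfamily. The
      choice of the empty subfamily keeps \<open>D\<close> nonempty even if \<open>X\<close> is
      empty.\<close>
    define D where "D = (\<lambda>Y. \<Squnion>\<^bsub>?L\<^esub>Y) ` {Y. finite Y \<and> Y \<subseteq> X}"
    have "\<Union>D \<in> C"
    proof (rule directed)
      show "D \<subseteq> C" "D \<noteq> {}"
        using X Sup_closed by (auto simp: D_def)
      fix F G assume "F \<in> D" "G \<in> D"
      then obtain Y Z where Y: "finite Y" "Y \<subseteq> X" "F = \<Squnion>\<^bsub>?L\<^esub>Y"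
        and Z: "finite Z" "Z \<subseteq> X" "G = \<Squnion>\<^bsub>?L\<^esub>Z"
        by (auto simp: D_def)
      have "\<Squnion>\<^bsub>?L\<^esub>(Y \<union> Z) \<in> D"
        using Y Z by (auto simp: D_def)
      moreover have YZ: "Y \<subseteq> C" "Z \<subseteq> C" "Y \<union> Z \<subseteq> C"
        using X Y Z by auto
      then have "F \<subseteq> \<Squnion>\<^bsub>?L\<^esub>(Y \<union> Z)" "G \<subseteq> \<Squnion>\<^bsub>?L\<^esub>(Y \<union> Z)"
        unfolding Y Z by (simp_all add: Sup_mono)
      ultimately show "\<exists>H\<in>D. F \<union> G \<subseteq> H"
        by blast
    qed
    moreover have "F \<subseteq> \<Union>D" if "F \<in> X" for F
    proof -
      have "\<Squnion>\<^bsub>?L\<^esub>{F} \<in> D"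
        using that by (auto simp: D_def)
      moreover have "F \<subseteq> \<Squnion>\<^bsub>?L\<^esub>{F}"
        using that X by (intro Sup_upper) auto
      ultimately show ?thesis
        by blast
    qed
    ultimately have "\<Squnion>\<^bsub>?L\<^esub>X \<subseteq> \<Union>D"
      using X by (intro Sup_least)
    then have "a \<in> \<Union>D"
      using le cl[OF a] by auto
    then obtain Y where Y: "finite Y" "Y \<subseteq> X" "a \<in> \<Squnion>\<^bsub>?L\<^esub>Y"
      by (auto simp: D_def)
    then have "cl a \<subseteq> \<Squnion>\<^bsub>?L\<^esub>Y"
      using X by (intro cl_least Sup_closed) auto
    with Y show "\<exists>Y\<subseteq>X. finite Y \<and> cl a \<sqsubseteq>\<^bsub>?L\<^esub> \<Squnion>\<^bsub>?L\<^esub>Y"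
      by auto
  qed
  show ?thesis
  proof
    fix F assume "F \<in> carrier ?L"
    then have F: "F \<in> C" "F \<subseteq> U"
      using top by auto
    have sub: "cl ` F \<subseteq> C"
      using F cl by auto
    have "F = \<Squnion>\<^bsub>?L\<^esub>(cl ` F)"
    proof
      show "F \<subseteq> \<Squnion>\<^bsub>?L\<^esub>(cl ` F)"
        using Sup_upper[OF sub] F cl by blast
      show "\<Squnion>\<^bsub>?L\<^esub>(cl ` F) \<subseteq> F"
        using sub F cl_least[OF F(1)] by (intro Sup_least) auto
    qed
    then show "\<exists>K. (\<forall>k\<in>K. compact_element ?L k) \<and> F = \<Squnion>\<^bsub>?L\<^esub>K"
      using compact F by (intro exI[of _ "cl ` F"]) auto
  qed
qed

section \<open>Finite algebras and the final algebra\<close>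

lemma finite_alg_iff:
  assumes "finite S"
  shows "finite_alg S A \<longleftrightarrow> (\<forall>s\<in>S. finite (car A s))"
proof
  assume "finite_alg S A"
  then have fin: "finite (SIGMA s:S. car A s)"
    by (simp add: finite_alg_def finite_sorted_set_def)
  show "\<forall>s\<in>S. finite (car A s)"
  proof
    fix s assume "s \<in> S"
    then have "car A s \<subseteq> snd ` (SIGMA s:S. car A s)"
      by force
    then show "finite (car A s)"
      using fin finite_subset by blast
  qed
qed (use assms in \<open>auto simp: finite_alg_def finite_sorted_set_def\<close>)

text \<open>A copy of the final algebra with elements of type \<open>'u\<close>; the empty product
  itself has functions as elements. With \<open>undefined\<close> as the only element, the same
  constant operation is correct inside the domain and is the required default outside it.\<close>

definition trivial_algebra :: "'s set \<Rightarrow> ('s, 'f, 'u) ms_algebra" where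
  "trivial_algebra S =
     \<lparr> car = (\<lambda>s. if s \<in> S then {undefined} else {}), opn = (\<lambda>_ _ _ _. undefined) \<rparr>"

lemma trivial_algebra_in_Alg: "trivial_algebra S \<in> Alg S \<Sigma>"
  by (auto simp: Alg_def trivial_algebra_def sorted_set_def op_symbol_def)

lemma trivial_algebra_subdirect_embedding:
  fixes C :: "'i \<Rightarrow> ('s, 'f, 'u) ms_algebra"
  shows "(\<lambda>s x i. undefined) \<in> subdirect_embedding S \<Sigma> (trivial_algebra S) {} C"
proof -
  let ?h = "\<lambda>(s :: 's) (x :: 'u) (i :: 'i). undefined :: 'u" and ?P = "product_algebra S \<Sigma> {} C"
  have car: "car ?P s = (if s \<in> S then {\<lambda>_. undefined} else {})" for s
    by (simp add: product_algebra_def Let_def)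
  have "opn ?P w s \<sigma> (map2 ?h w xs) = (\<lambda>_. undefined)"
    if op: "op_symbol S \<Sigma> w s \<sigma>"
      and xs: "xs \<in> word_product (car (trivial_algebra S :: ('s, 'f, 'u) ms_algebra)) w"
    for w s \<sigma> xs
  proof -
    have "w ! i \<in> S" if "i < length w" for i
      using op that nth_mem[of i w] by (auto simp: op_symbol_def)
    moreover have "length xs = length w"
      using xs by (simp add: word_product_def)
    \<comment> \<open>Membership in the domain matters: outside it the product operation is the
      function-valued \<open>undefined\<close>, which is not known to be the constant function with
      value \<open>undefined\<close>.\<close>
    ultimately have "map2 ?h w xs \<in> word_product (car ?P) w"
      by (simp add: word_product_def car)
    then show ?thesis
      using op by (simp add: product_algebra_def Let_def restrict_def)
  qed
  then show ?thesis
    by (simp add: subdirect_embedding_def ms_hom_def car) (simp add: trivial_algebra_def)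
qed

section \<open>Intersections and directed unions of formations\<close>

lemma formationI:
  assumes "F \<subseteq> Alg S \<Sigma>" "F \<noteq> {}"
    and "\<And>A B. B \<in> F \<Longrightarrow> A \<in> Alg S \<Sigma> \<Longrightarrow> ms_iso S \<Sigma> B A \<noteq> {} \<Longrightarrow> A \<in> F"
    and "\<And>A B. B \<in> F \<Longrightarrow> A \<in> Alg S \<Sigma> \<Longrightarrow> ms_epi S \<Sigma> B A \<noteq> {} \<Longrightarrow> A \<in> F"
    and "\<And>A C n. (\<And>\<alpha>. \<alpha> < n \<Longrightarrow> C \<alpha> \<in> F) \<Longrightarrow> A \<in> Alg S \<Sigma> \<Longrightarrow>
      subdirect_embedding S \<Sigma> A {..<n::nat} C \<noteq> {} \<Longrightarrow> A \<in> F"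
  shows "formation S \<Sigma> F"
  unfolding formation_def
proof (intro conjI ballI allI impI)
  fix A C and n :: nat
  assume C: "\<forall>\<alpha><n. C \<alpha> \<in> F"
    and A: "A \<in> Alg S \<Sigma>" "subdirect_embedding S \<Sigma> A {..<n} C \<noteq> {}"
  from C have "C \<alpha> \<in> F" if "\<alpha> < n" for \<alpha>
    using that by simp
  from assms(5)[OF this A] show "A \<in> F" .
qed (fact assms(1) assms(2) | erule (2) assms(3) assms(4))+

lemma formationD:
  assumes "formation S \<Sigma> F"
  shows formation_subset_Alg: "F \<subseteq> Alg S \<Sigma>"
    and formation_iso: "B \<in> F \<Longrightarrow> A \<in> Alg S \<Sigma> \<Longrightarrow> ms_iso S \<Sigma> B A \<noteq> {} \<Longrightarrow> A \<in> F"
    and formation_epi: "B \<in> F \<Longrightarrow> A \<in> Alg S \<Sigma> \<Longrightarrow> ms_epi S \<Sigma> B A \<noteq> {} \<Longrightarrow> A \<in> F"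
    and formation_subdirect: "(\<And>\<alpha>. \<alpha> < n \<Longrightarrow> C \<alpha> \<in> F) \<Longrightarrow> A \<in> Alg S \<Sigma> \<Longrightarrow>
      subdirect_embedding S \<Sigma> A {..<n::nat} C \<noteq> {} \<Longrightarrow> A \<in> F"
proof -
  note form = assms[unfolded formation_def]
  show "F \<subseteq> Alg S \<Sigma>"
    using form by (rule conjunct1)
  show "A \<in> F" if "B \<in> F" "A \<in> Alg S \<Sigma>" "ms_iso S \<Sigma> B A \<noteq> {}"
    using form that by blast
  show "A \<in> F" if "B \<in> F" "A \<in> Alg S \<Sigma>" "ms_epi S \<Sigma> B A \<noteq> {}"
    using form that by blast
  show "A \<in> F" if "\<And>\<alpha>. \<alpha> < n \<Longrightarrow> C \<alpha> \<in> F" "A \<in> Alg S \<Sigma>"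
    "subdirect_embedding S \<Sigma> A {..<n} C \<noteq> {}"
    using form that by blast
qed

text \<open>The subdirect rule with n = 0 has no factors to supply. The resulting common member
  keeps intersections nonempty.\<close>

lemma trivial_algebra_in_formation:
  assumes "formation S \<Sigma> F"
  shows "trivial_algebra S \<in> F"
proof (rule formation_subdirect[OF assms])
  show "subdirect_embedding S \<Sigma> (trivial_algebra S) {..<0::nat} (\<lambda>_. trivial_algebra S) \<noteq> {}"
    using trivial_algebra_subdirect_embedding by (metis empty_iff lessThan_0)
qed (simp_all add: trivial_algebra_in_Alg)

lemma formation_Inter:
  fixes X :: "('s, 'f, 'u) ms_algebra set set"
  assumes "X \<noteq> {}" and form: "\<And>F. F \<in> X \<Longrightarrow> formation S \<Sigma> F"
  shows "formation S \<Sigma> (\<Inter>X)"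
proof (rule formationI)
  show "\<Inter>X \<subseteq> Alg S \<Sigma>"
    using assms formation_subset_Alg by fast
  show "\<Inter>X \<noteq> {}"
    using trivial_algebra_in_formation[OF form] by blast
next
  fix A B :: "('s, 'f, 'u) ms_algebra"
  assume B: "B \<in> \<Inter>X" and A: "A \<in> Alg S \<Sigma>" "ms_iso S \<Sigma> B A \<noteq> {}"
  show "A \<in> \<Inter>X"
  proof
    fix F assume F: "F \<in> X"
    from F B have "B \<in> F" by simp
    from formation_iso[OF form[OF F] this A] show "A \<in> F" .
  qed
next
  fix A B :: "('s, 'f, 'u) ms_algebra"
  assume B: "B \<in> \<Inter>X" and A: "A \<in> Alg S \<Sigma>" "ms_epi S \<Sigma> B A \<noteq> {}"
  show "A \<in> \<Inter>X"
  proof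
    fix F assume F: "F \<in> X"
    from F B have "B \<in> F" by simp
    from formation_epi[OF form[OF F] this A] show "A \<in> F" .
  qed
next
  fix A :: "('s, 'f, 'u) ms_algebra" and C and n :: nat
  assume C: "\<And>\<alpha>. \<alpha> < n \<Longrightarrow> C \<alpha> \<in> \<Inter>X"
    and A: "A \<in> Alg S \<Sigma>" "subdirect_embedding S \<Sigma> A {..<n} C \<noteq> {}"
  show "A \<in> \<Inter>X"
  proof
    fix F assume F: "F \<in> X"
    with C have "C \<alpha> \<in> F" if "\<alpha> < n" for \<alpha>
      using that by blast
    from formation_subdirect[OF form[OF F] this A] show "A \<in> F" .
  qed
qed

text \<open>Directedness is stated for pairs; induction on \<open>n\<close> extends it to finite
  families, with nonemptiness of \<open>X\<close> as the base case. This brings all factors of a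
  subdirect product into one formation.\<close>

lemma directed_finite_family:
  fixes n :: nat
  assumes "X \<noteq> {}" "\<And>F G. F \<in> X \<Longrightarrow> G \<in> X \<Longrightarrow> \<exists>H\<in>X. F \<union> G \<subseteq> H"
    and "\<forall>\<alpha><n. C \<alpha> \<in> \<Union>X"
  shows "\<exists>F\<in>X. \<forall>\<alpha><n. C \<alpha> \<in> F"
  using assms(3)
proof (induction n)
  case 0
  then show ?case using assms(1) by auto
next
  case (Suc n)
  then obtain F G where "F \<in> X" "\<forall>\<alpha><n. C \<alpha> \<in> F" "G \<in> X" "C n \<in> G"
    by auto
  moreover then obtain H where "H \<in> X" "F \<union> G \<subseteq> H"
    using assms(2) by blast
  ultimately have "\<forall>\<alpha><Suc n. C \<alpha> \<in> H"
    by (auto simp: less_Suc_eq)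
  with \<open>H \<in> X\<close> show ?case
    by blast
qed

text \<open>Only the subdirect rule can have several premises, so directedness is needed for that
  rule alone; for isomorphic copies and quotients one member of \<open>X\<close> suffices.\<close>

lemma formation_directed_Union:
  fixes X :: "('s, 'f, 'u) ms_algebra set set"
  assumes "X \<noteq> {}" "\<And>F G. F \<in> X \<Longrightarrow> G \<in> X \<Longrightarrow> \<exists>H\<in>X. F \<union> G \<subseteq> H"
    and form: "\<And>F. F \<in> X \<Longrightarrow> formation S \<Sigma> F"
  shows "formation S \<Sigma> (\<Union>X)"
proof (rule formationI)
  show "\<Union>X \<subseteq> Alg S \<Sigma>"
    using formation_subset_Alg[OF form] by blast
  show "\<Union>X \<noteq> {}"
    using trivial_algebra_in_formation[OF form] assms(1) by blast
next
  fix A :: "('s, 'f, 'u) ms_algebra" and C and n :: nat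
  assume C: "\<And>\<alpha>. \<alpha> < n \<Longrightarrow> C \<alpha> \<in> \<Union>X"
    and A: "A \<in> Alg S \<Sigma>" "subdirect_embedding S \<Sigma> A {..<n} C \<noteq> {}"
  obtain F where F: "F \<in> X" "\<forall>\<alpha><n. C \<alpha> \<in> F"
    using directed_finite_family[OF assms(1,2), of n C] C by blast
  then have "C \<alpha> \<in> F" if "\<alpha> < n" for \<alpha>
    using that by simp
  from formation_subdirect[OF form[OF F(1)] this A] have "A \<in> F" .
  with F(1) show "A \<in> \<Union>X" by (rule UnionI)
next
  fix A B :: "('s, 'f, 'u) ms_algebra"
  assume B: "B \<in> \<Union>X" and A: "A \<in> Alg S \<Sigma>" "ms_iso S \<Sigma> B A \<noteq> {}"
  from B obtain F where F: "F \<in> X" "B \<in> F" ..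
  from F(1) formation_iso[OF form[OF F(1)] F(2) A] show "A \<in> \<Union>X" ..
next
  fix A B :: "('s, 'f, 'u) ms_algebra"
  assume B: "B \<in> \<Union>X" and A: "A \<in> Alg S \<Sigma>" "ms_epi S \<Sigma> B A \<noteq> {}"
  from B obtain F where F: "F \<in> X" "B \<in> F" ..
  from F(1) formation_epi[OF form[OF F(1)] F(2) A] show "A \<in> \<Union>X" ..
qed

section \<open>Finiteness under subdirect products and quotients\<close>

lemma finite_alg_subdirect:
  assumes "finite S" "finite I" "\<And>i. i \<in> I \<Longrightarrow> finite_alg S (C i)"
    and f: "f \<in> subdirect_embedding S \<Sigma> A I C"
  shows "finite_alg S A"
  unfolding finite_alg_iff[OF assms(1)]
proof
  fix s assume s: "s \<in> S"
  have "f s ` car A s \<subseteq> (\<Pi>\<^sub>E i\<in>I. car (C i) s)"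
    using f s by (auto simp: subdirect_embedding_def ms_hom_def product_algebra_def Let_def)
  moreover have "finite (\<Pi>\<^sub>E i\<in>I. car (C i) s)"
    using assms s by (intro finite_PiE) (auto simp: finite_alg_iff)
  moreover have "inj_on (f s) (car A s)"
    using f s by (simp add: subdirect_embedding_def)
  ultimately show "finite (car A s)"
    using inj_on_finite by blast
qed

lemma finite_alg_epi:
  assumes "finite S" "finite_alg S B" "h \<in> ms_epi S \<Sigma> B A"
  shows "finite_alg S A"
  unfolding finite_alg_iff[OF assms(1)]
proof
  fix s assume s: "s \<in> S"
  then have "car A s = h s ` car B s"
    using assms(3) by (simp add: ms_epi_def)
  then show "finite (car A s)"
    using assms s by (simp add: finite_alg_iff)
qed

text \<open>Finiteness of \<open>S\<close> is essential: over infinitely many sorts the final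
  algebra, which lies in every formation, is infinite, so no formation of finite algebras would
  exist.\<close>

lemma finite_formation_all:
  assumes "finite S"
  shows "finite_formation S \<Sigma> {A \<in> Alg S \<Sigma>. finite_alg S A}"
proof -
  let ?U = "{A \<in> Alg S \<Sigma>. finite_alg S A}"
  have "formation S \<Sigma> ?U"
  proof (rule formationI)
    have "trivial_algebra S \<in> ?U"
      using trivial_algebra_in_Alg assms by (auto simp: finite_alg_iff trivial_algebra_def)
    then show "?U \<noteq> {}"
      by blast
  next
    fix A B assume "B \<in> ?U" "A \<in> Alg S \<Sigma>" "ms_epi S \<Sigma> B A \<noteq> {}"
    then show "A \<in> ?U"
      using finite_alg_epi[OF assms] by blast
  next
    fix A B assume "B \<in> ?U" "A \<in> Alg S \<Sigma>" "ms_iso S \<Sigma> B A \<noteq> {}"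
    moreover have "ms_iso S \<Sigma> B A \<subseteq> ms_epi S \<Sigma> B A"
      by (auto simp: ms_iso_def ms_epi_def bij_betw_def)
    ultimately show "A \<in> ?U"
      using finite_alg_epi[OF assms] by blast
  next
    fix A C and n :: nat
    assume "\<And>\<alpha>. \<alpha> < n \<Longrightarrow> C \<alpha> \<in> ?U" "A \<in> Alg S \<Sigma>"
      "subdirect_embedding S \<Sigma> A {..<n} C \<noteq> {}"
    then show "A \<in> ?U"
      using finite_alg_subdirect[OF assms, of "{..<n}" C] by auto
  qed blast
  then show ?thesis
    by (simp add: finite_formation_def)
qed

section \<open>From finite supports to the lattice of formations\<close>

text \<open>If every sort in \<open>S\<close> has a variable, the support of the free algebra is all
  of \<open>S\<close>. Such a family exists because the type \<open>'u\<close> is inhabited.\<close>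

lemma finite_sorts:
  fixes S :: "'s set" and \<Sigma> :: "('s, 'f) signature"
  assumes "\<And>A :: 's \<Rightarrow> 'u set. sorted_set S A \<Longrightarrow>
      finite (support S (car (free_algebra S \<Sigma> A)))"
  shows "finite S"
proof -
  let ?A = "\<lambda>s. if s \<in> S then UNIV :: 'u set else {}"
  have "well_sorted S \<Sigma> ?A s (Var s undefined)" if "s \<in> S" for s
    using that by (intro well_sorted.Var) auto
  then have "support S (car (free_algebra S \<Sigma> ?A)) = S"
    by (auto simp: support_def free_algebra_def Let_def)
  then show ?thesis
    using assms[of ?A] by (simp add: sorted_set_def)
qed

theorem corollary6p13:
  fixes S :: "'s set" and \<Sigma> :: "('s, 'f) signature"
  assumes "\<And>A :: 's \<Rightarrow> 'u set. sorted_set S A \<Longrightarrow>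
      finite (support S (car (free_algebra S \<Sigma> A)))"
  shows "algebraic_lattice (Form_fin S \<Sigma> :: ('s, 'f, 'u) ms_algebra set gorder)"
  unfolding Form_fin_def
proof (rule algebraic_lattice_closure_system)
  \<comment> \<open>Finiteness of \<open>S\<close> enters only through the greatest element; the
    closure under intersections and directed unions holds over any set of sorts.\<close>
  have "finite S"
    using assms by (rule finite_sorts)
  then show "{A \<in> Alg S \<Sigma>. finite_alg S A} \<in> {F. finite_formation S \<Sigma> F}"
    by (simp add: finite_formation_all)
  show "F \<subseteq> {A \<in> Alg S \<Sigma>. finite_alg S A}" if "F \<in> {F. finite_formation S \<Sigma> F}"
    for F :: "('s, 'f, 'u) ms_algebra set"
    using that formation_subset_Alg[of S \<Sigma> F] by (auto simp: finite_formation_def)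
next
  fix X :: "('s, 'f, 'u) ms_algebra set set"
  assume X: "X \<subseteq> {F. finite_formation S \<Sigma> F}" "X \<noteq> {}"
  have form: "formation S \<Sigma> F" if "F \<in> X" for F
    using X(1) that by (auto simp: finite_formation_def)
  \<comment> \<open>As \<open>X\<close> is nonempty, \<open>A\<close> lies in at least one formation
    of finite algebras.\<close>
  have "finite_alg S A" if "A \<in> \<Inter>X" for A
    using that X by (auto simp: finite_formation_def)
  with formation_Inter[OF X(2) form] show "\<Inter>X \<in> {F. finite_formation S \<Sigma> F}"
    by (simp add: finite_formation_def)
next
  fix X :: "('s, 'f, 'u) ms_algebra set set"
  assume X: "X \<subseteq> {F. finite_formation S \<Sigma> F}" "X \<noteq> {}"
    and directed: "\<And>F G. F \<in> X \<Longrightarrow> G \<in> X \<Longrightarrow> \<exists>H\<in>X. F \<union> G \<subseteq> H"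
  have form: "formation S \<Sigma> F" if "F \<in> X" for F
    using X(1) that by (auto simp: finite_formation_def)
  have "finite_alg S A" if "A \<in> \<Union>X" for A
    using that X by (auto simp: finite_formation_def)
  with formation_directed_Union[OF X(2) directed form]
  show "\<Union>X \<in> {F. finite_formation S \<Sigma> F}"
    by (simp add: finite_formation_def)
qed

end
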